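(* Let $K/\mathbb{Q}$ be a Galois extension of odd degree and suppose $E/K$ is an elliptic curve totally balanced at a prime $\mathfrak{l}$ of $K$ above an odd prime $\ell$. Then $$\mathrm{tr}\left(\rho_{E,\ell}(G_K)\right)\subseteq\left(\frac{2}{\ell}\right)\cdot\mathbb{F}_\ell^{\times2}\cup\{0\}.$$
   Context: $G_K=\mathrm{Gal}(\overline{\mathbb{Q}}/K)$, $\rho_{E,\ell}:G_K\to\mathrm{GL}_2(\mathbb{F}_\ell)$ is the representation on $E[\ell]$, $\left(\frac{2}{\ell}\right)=\pm1$ is the Legendre symbol, and $\mathbb{F}_\ell^{\times2}$ is the group of nonzero squares in $\mathbb{F}_\ell$. Heavenly: an elliptic curve $E$ over a number field $K$ is heavenly at a prime $\ell$ if $K(E[\ell^\infty])$ is contained in the maximal pro-$\ell$ extension of $K(\mu_{\ell^\infty})$ unramified away from $\ell$; equivalently, $E$ has good reduction at all primes of $K$ not dividing $\ell$ and $[K(E[\ell]):K(\mu_\ell)]$ is a power of $\ell$. Balanced: let $\ell$ be an odd prime, $E/K$ heavenly at $\ell$, and $\chi:G_{\mathbb{Q}}\to\mathbb{F}_\ell^\times$ the mod $\ell$ cyclotomic character. In a suitable basis of $E[\ell]$, $\rho_{E,\ell}\sim\begin{pmatrix}\chi^{i_1}&\star\\0&\chi^{i_2}\end{pmatrix}$ on $G_K$ for integers $i_1,i_2$, chosen with $i_1+i_2\equiv1\pmod{\ell-1}$. Let $\mathfrak{l}\mid\ell$ be a prime of $K$ with ramification index $e_{\mathfrak{l}}$ over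 $\mathbb{Q}$, let $K_{\mathfrak{l}}^{\mathrm{unr}}$ be the maximal unramified extension of the completion $K_{\mathfrak l}$, and $K_{\mathfrak{l}}^{\mathrm{ss}}$ the minimal extension of $K_{\mathfrak{l}}^{\mathrm{unr}}$ over which $E$ has semistable reduction. Put $e=e_E(\mathfrak{l})=e_{\mathfrak{l}}\,[K_{\mathfrak{l}}^{\mathrm{ss}}:K_{\mathfrak{l}}^{\mathrm{unr}}]$. The Tate–Oort numbers $j_{\mathfrak{l},1},j_{\mathfrak{l},2}$ of $E$ at $\mathfrak{l}$ are integers in $[0,e]$ with $j_{\mathfrak{l},1}+j_{\mathfrak{l},2}=e$ and $e\,i_r\equiv j_{\mathfrak{l},r}\pmod{\ell-1}$ for $r=1,2$, determined by the $\ell$-torsion as a group scheme, as follows. If $E$ has good reduction over $K_{\mathfrak{l}}^{\mathrm{ss}}$, with Néron model $\mathcal{E}$ over its ring of integers $\mathcal{O}'$, the filtration $0\subset V_1\subset E[\ell]$ given by the triangular form extends (by schematic closure) to $\mathcal{E}[\ell]$, and the two graded pieces are finite flat group schemes of order $\ell$ over $\mathcal{O}'$; by Oort–Tate each has underlying scheme $\mathrm{Spec}\,\mathcal{O}'[x]/(x^\ell-a_rx)$, and $j_{\mathfrak{l},r}=v(a_r)$ with $v$ the normalized valuation (value group $\mathbb{Z}$). If $E$ has multiplicative reduction over $K_{\mathfrak{l}}^{\mathrm{ss}}$, the Tate–Oort numbers are $0$ and $e$. $E$ is balanced at $\mathfrak{l}$ if $j_{\mathfrak{l},1}=j_{\mathfrak{l},2}=e/2$.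 Totally balanced: $E$ (necessarily heavenly at $\ell$) is totally balanced at $\mathfrak{l}\mid\ell$ if it is balanced at $\mathfrak{l}$ and $\{i_1,i_2\}\equiv\{\frac{\ell+1}{4},\frac{3\ell-1}{4}\}\pmod{\ell-1}$, i.e. the diagonal characters of $\rho_{E,\ell}$ are $\chi^{(\ell+1)/4}$ and $\chi^{(3\ell-1)/4}$. (For $K/\mathbb{Q}$ Galois of odd degree, balanced at $\mathfrak{l}$ forces $\ell\equiv3\pmod4$, so these exponents are integers.) *)

theory Defs
  imports
    "HOL-Analysis.Analysis"
    "HOL-Algebra.Algebra"
    "HOL-Algebra.Algebraic_Closure_Type"
    "HOL-Number_Theory.Number_Theory"
    "Berlekamp_Zassenhaus.Finite_Field"
begin

section \<open>Fields of algebraic numbers and Galois groups\<close>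

text \<open>All fields live inside the complex numbers; a subfield is its carrier set.\<close>

abbreviation \<C> :: "complex ring" where
  "\<C> \<equiv> ring_of_type_algebra"

abbreviation is_degree :: "complex set \<Rightarrow> complex set \<Rightarrow> nat \<Rightarrow> bool" where
  "is_degree F L n \<equiv> ring.dimension \<C> n F L"

definition Qbar :: "complex set" where
  "Qbar = {z. algebraic z}"

definition Zbar :: "complex set" where
  "Zbar = {z. algebraic_int z}"

definition ring_of_integers :: "complex set \<Rightarrow> complex set" where
  "ring_of_integers K = K \<inter> Zbar"

definition prime_above :: "complex set \<Rightarrow> nat \<Rightarrow> complex set \<Rightarrow> bool" where
  "prime_above K l \<ll> \<longleftrightarrow>
     primeideal \<ll> (\<C>\<lparr>carrier := ring_of_integers K\<rparr>) \<and> of_nat l \<in> \<ll>"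

text \<open>Elements are total functions of which only the restriction to \<^const>\<open>Qbar\<close> matters.\<close>

definition abs_gal :: "complex set \<Rightarrow> (complex \<Rightarrow> complex) set" where
  "abs_gal F = {\<sigma>. bij_betw \<sigma> Qbar Qbar
     \<and> (\<forall>x\<in>Qbar. \<forall>y\<in>Qbar. \<sigma> (x + y) = \<sigma> x + \<sigma> y \<and> \<sigma> (x * y) = \<sigma> x * \<sigma> y)
     \<and> (\<forall>x\<in>F. \<sigma> x = x)}"

text \<open>For algebraic extensions in characteristic 0, Galois means normal.\<close>

definition galois_ext :: "complex set \<Rightarrow> complex set \<Rightarrow> bool" where
  "galois_ext F L \<longleftrightarrow> subfield F \<C> \<and> subfield L \<C> \<and> F \<subseteq> L \<and> L \<subseteq> Qbar
     \<and> (\<forall>\<sigma>\<in>abs_gal F. \<sigma> ` L = L)"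

definition inertia :: "complex set \<Rightarrow> complex set \<Rightarrow> (complex \<Rightarrow> complex) set" where
  "inertia F \<PP> = {\<sigma>\<in>abs_gal F. \<forall>x\<in>Zbar. \<sigma> x - x \<in> \<PP>}"

text \<open>The field \<open>F\<close> may be of infinite degree over the rationals, so ramification is expressed by
  the inertia groups at the primes of \<^const>\<open>Zbar\<close>. The archimedean places need no condition in
  extensions of odd degree.\<close>

definition unramified_away :: "nat \<Rightarrow> complex set \<Rightarrow> complex set \<Rightarrow> bool" where
  "unramified_away l F L \<longleftrightarrow>
     (\<forall>\<PP>. maximalideal \<PP> (\<C>\<lparr>carrier := Zbar\<rparr>) \<and> of_nat l \<notin> \<PP>
        \<longrightarrow> (\<forall>\<sigma>\<in>inertia F \<PP>. \<forall>x\<in>L. \<sigma> x = x))"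

definition max_pro_ext_unramified_away :: "nat \<Rightarrow> complex set \<Rightarrow> complex set" where
  "max_pro_ext_unramified_away l F =
     \<Union>{L. galois_ext F L \<and> (\<exists>n. is_degree F L (l ^ n)) \<and> unramified_away l F L}"

definition cyclotomic_tower :: "complex set \<Rightarrow> nat \<Rightarrow> complex set" where
  "cyclotomic_tower K l = generate_field \<C> (K \<union> {\<zeta>. \<exists>n. \<zeta> ^ (l ^ n) = 1})"

text \<open>The mod \<open>l\<close> cyclotomic character, where \<open>l = CARD('p)\<close>.\<close>

definition cyclo_char :: "(complex \<Rightarrow> complex) \<Rightarrow> 'p::prime_card mod_ring" where
  "cyclo_char \<sigma> = (THE c. \<forall>\<zeta>. \<zeta> ^ CARD('p) = 1 \<longrightarrow> \<sigma> \<zeta> = \<zeta> ^ nat (to_int_mod_ring c))"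

section \<open>Elliptic curves\<close>

text \<open>Weierstrass equations
  \<open>y\<^sup>2 + a\<^sub>1 x y + a\<^sub>3 y = x\<^sup>3 + a\<^sub>2 x\<^sup>2 + a\<^sub>4 x + a\<^sub>6\<close>.\<close>

datatype weierstrass =
  Weierstrass (a1: complex) (a2: complex) (a3: complex) (a4: complex) (a6: complex)

definition coeffs_in :: "complex set \<Rightarrow> weierstrass \<Rightarrow> bool" where
  "coeffs_in R E \<longleftrightarrow> {a1 E, a2 E, a3 E, a4 E, a6 E} \<subseteq> R"

definition b2 :: "weierstrass \<Rightarrow> complex" where
  "b2 E = (a1 E)\<^sup>2 + 4 * a2 E"

definition b4 :: "weierstrass \<Rightarrow> complex" where
  "b4 E = 2 * a4 E + a1 E * a3 E"

definition b6 :: "weierstrass \<Rightarrow> complex" where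
  "b6 E = (a3 E)\<^sup>2 + 4 * a6 E"

definition b8 :: "weierstrass \<Rightarrow> complex" where
  "b8 E = (a1 E)\<^sup>2 * a6 E + 4 * a2 E * a6 E - a1 E * a3 E * a4 E + a2 E * (a3 E)\<^sup>2 - (a4 E)\<^sup>2"

definition c4 :: "weierstrass \<Rightarrow> complex" where
  "c4 E = (b2 E)\<^sup>2 - 24 * b4 E"

definition disc :: "weierstrass \<Rightarrow> complex" where
  "disc E = - (b2 E)\<^sup>2 * b8 E - 8 * (b4 E) ^ 3 - 27 * (b6 E)\<^sup>2 + 9 * b2 E * b4 E * b6 E"

definition elliptic_curve :: "complex set \<Rightarrow> weierstrass \<Rightarrow> bool" where
  "elliptic_curve K E \<longleftrightarrow> coeffs_in K E \<and> disc E \<noteq> 0"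

text \<open>The equation in the coordinates \<open>x'\<close>, \<open>y'\<close> with
  \<open>x = u\<^sup>2 x' + r\<close> and \<open>y = u\<^sup>3 y' + u\<^sup>2 s x' + t\<close>.\<close>

definition change_coords ::
    "complex \<Rightarrow> complex \<Rightarrow> complex \<Rightarrow> complex \<Rightarrow> weierstrass \<Rightarrow> weierstrass" where
  "change_coords u r s t E = Weierstrass
     ((a1 E + 2 * s) / u)
     ((a2 E - s * a1 E + 3 * r - s\<^sup>2) / u\<^sup>2)
     ((a3 E + r * a1 E + 2 * t) / u ^ 3)
     ((a4 E - s * a3 E + 2 * r * a2 E - (t + r * s) * a1 E + 3 * r\<^sup>2 - 2 * s * t) / u ^ 4)
     ((a6 E + r * a4 E + r\<^sup>2 * a2 E + r ^ 3 - t * a3 E - t\<^sup>2 - r * t * a1 E) / u ^ 6)"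

datatype point = Infinity | Affine complex complex

definition on_curve :: "weierstrass \<Rightarrow> complex \<Rightarrow> complex \<Rightarrow> bool" where
  "on_curve E x y \<longleftrightarrow>
     y\<^sup>2 + a1 E * x * y + a3 E * y = x ^ 3 + a2 E * x\<^sup>2 + a4 E * x + a6 E"

definition points :: "weierstrass \<Rightarrow> point set" where
  "points E = insert Infinity {Affine x y | x y. x \<in> Qbar \<and> y \<in> Qbar \<and> on_curve E x y}"

text \<open>The chord-tangent law; \<open>m\<close> is the slope of the chord or tangent.\<close>

fun add_point :: "weierstrass \<Rightarrow> point \<Rightarrow> point \<Rightarrow> point" where
  "add_point E Infinity Q = Q"
| "add_point E P Infinity = P"
| "add_point E (Affine x1 y1) (Affine x2 y2) =
     (if x1 = x2 \<and> y1 + y2 + a1 E * x2 + a3 E = 0 then Infinity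
      else let m = (if x1 = x2
                    then (3 * x1\<^sup>2 + 2 * a2 E * x1 + a4 E - a1 E * y1) / (2 * y1 + a1 E * x1 + a3 E)
                    else (y2 - y1) / (x2 - x1));
               x3 = m\<^sup>2 + a1 E * m - a2 E - x1 - x2;
               y3 = - (y1 + m * (x3 - x1)) - a1 E * x3 - a3 E
           in Affine x3 y3)"

definition mult_point :: "weierstrass \<Rightarrow> nat \<Rightarrow> point \<Rightarrow> point" where
  "mult_point E n P = (add_point E P ^^ n) Infinity"

definition torsion :: "weierstrass \<Rightarrow> nat \<Rightarrow> point set" where
  "torsion E n = {P \<in> points E. mult_point E n P = Infinity}"

fun coords :: "point \<Rightarrow> complex set" where
  "coords Infinity = {}"
| "coords (Affine x y) = {x, y}"

definition torsion_tower :: "complex set \<Rightarrow> weierstrass \<Rightarrow> nat \<Rightarrow> complex set" where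
  "torsion_tower K E l =
     generate_field \<C> (K \<union> (\<Union>n. \<Union>P\<in>torsion E (l ^ n). coords P))"

definition heavenly :: "nat \<Rightarrow> complex set \<Rightarrow> weierstrass \<Rightarrow> bool" where
  "heavenly l K E \<longleftrightarrow> elliptic_curve K E
     \<and> torsion_tower K E l \<subseteq> max_pro_ext_unramified_away l (cyclotomic_tower K l)"

section \<open>The mod \<open>l\<close> representation\<close>

fun gal_point :: "(complex \<Rightarrow> complex) \<Rightarrow> point \<Rightarrow> point" where
  "gal_point \<sigma> Infinity = Infinity"
| "gal_point \<sigma> (Affine x y) = Affine (\<sigma> x) (\<sigma> y)"

definition lin_comb :: "weierstrass \<Rightarrow> point \<Rightarrow> point \<Rightarrow> 'p::prime_card mod_ring ^ 2 \<Rightarrow> point" where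
  "lin_comb E P Q w = add_point E (mult_point E (nat (to_int_mod_ring (w $ 1))) P)
                                  (mult_point E (nat (to_int_mod_ring (w $ 2))) Q)"

text \<open>The coordinate isomorphism onto the \<open>l\<close>-torsion attached to a fixed choice of basis
  (\<open>l = CARD('p)\<close>), which is immaterial up to conjugation and turns the Galois action into matrices acting on column vectors.\<close>

definition torsion_iso :: "weierstrass \<Rightarrow> 'p::prime_card mod_ring ^ 2 \<Rightarrow> point" where
  "torsion_iso E = (SOME \<phi>. \<exists>P\<in>torsion E CARD('p). \<exists>Q\<in>torsion E CARD('p).
     \<phi> = lin_comb E P Q \<and> bij_betw \<phi> UNIV (torsion E CARD('p)))"

definition rho :: "weierstrass \<Rightarrow> (complex \<Rightarrow> complex) \<Rightarrow> 'p::prime_card mod_ring ^ 2 ^ 2" where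
  "rho E \<sigma> = (THE M. \<forall>w. gal_point \<sigma> (torsion_iso E w) = torsion_iso E (M *v w))"

text \<open>Passing to the basis formed by the columns of \<open>g\<close> makes the representation upper triangular
  with diagonal characters the powers of the cyclotomic character with exponents
  \<open>i\<^sub>1\<close>, \<open>i\<^sub>2\<close>.\<close>

definition triangular_form ::
    "complex set \<Rightarrow> weierstrass \<Rightarrow> 'p::prime_card mod_ring ^ 2 ^ 2 \<Rightarrow> int \<Rightarrow> int \<Rightarrow> bool" where
  "triangular_form K E g i1 i2 \<longleftrightarrow> invertible g
     \<and> [i1 + i2 = 1] (mod (int CARD('p) - 1))
     \<and> (\<forall>\<sigma>\<in>abs_gal K. let T = matrix_inv g ** rho E \<sigma> ** g in
          T $ 1 $ 1 = cyclo_char \<sigma> powi i1 \<and> T $ 2 $ 1 = 0 \<and> T $ 2 $ 2 = cyclo_char \<sigma> powi i2)"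

section \<open>Local fields\<close>

text \<open>The local constructions at a prime of \<open>K\<close> take place in a complete algebraically
  closed field. As an abstract field \<open>\<complex>\<^sub>l\<close> is isomorphic to \<open>\<complex>\<close>, by an isomorphism
  that may be prescribed on \<^const>\<open>Qbar\<close>; hence a prime of \<open>K\<close> is cut out by a complete
  nonarchimedean absolute value \<open>v\<close> on the field of complex numbers, unrelated to the usual one.
  Completions are closures with respect to \<open>v\<close>, and the algebraic closure of \<open>K\<close> stays the same
  as in the global setting.\<close>

definition complete_abs :: "(complex \<Rightarrow> real) \<Rightarrow> bool" where
  "complete_abs v \<longleftrightarrow>
     (\<forall>x. 0 \<le> v x \<and> (v x = 0 \<longleftrightarrow> x = 0))
   \<and> (\<forall>x y. v (x * y) = v x * v y)
   \<and> (\<forall>x y. v (x + y) \<le> max (v x) (v y))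
   \<and> (\<forall>s :: nat \<Rightarrow> complex.
        (\<forall>\<epsilon>>0. \<exists>N. \<forall>m\<ge>N. \<forall>n\<ge>N. v (s m - s n) < \<epsilon>)
        \<longrightarrow> (\<exists>x. (\<lambda>n. v (s n - x)) \<longlonglongrightarrow> 0))"

definition induces_prime :: "(complex \<Rightarrow> real) \<Rightarrow> complex set \<Rightarrow> complex set \<Rightarrow> bool" where
  "induces_prime v K \<ll> \<longleftrightarrow> complete_abs v \<and> {x \<in> ring_of_integers K. v x < 1} = \<ll>"

definition completion :: "(complex \<Rightarrow> real) \<Rightarrow> complex set \<Rightarrow> complex set" where
  "completion v K = {z. \<forall>\<epsilon>>0. \<exists>x\<in>K. v (z - x) < \<epsilon>}"

definition val_ring :: "(complex \<Rightarrow> real) \<Rightarrow> complex set \<Rightarrow> complex set" where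
  "val_ring v L = {x \<in> L. v x \<le> 1}"

text \<open>The normalized valuation of a subfield on which \<open>v\<close> is discrete, at a nonzero element;
  \<open>\<pi>\<close> is a uniformizer.\<close>

definition normalized_val :: "(complex \<Rightarrow> real) \<Rightarrow> complex set \<Rightarrow> complex \<Rightarrow> int" where
  "normalized_val v L x = (THE n. \<exists>\<pi>\<in>L. \<pi> \<noteq> 0 \<and> v \<pi> < 1
     \<and> (\<forall>y\<in>L. v y < 1 \<longrightarrow> v y \<le> v \<pi>) \<and> v x = v \<pi> powi n)"

definition finite_ext :: "complex set \<Rightarrow> complex set \<Rightarrow> bool" where
  "finite_ext F L \<longleftrightarrow> subfield L \<C> \<and> F \<subseteq> L \<and> (\<exists>n. is_degree F L n)"

text \<open>Residue fields of completions of number fields are finite, hence a finite extension is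
  unramified iff it has ramification index 1, i.e. the same value group.\<close>

definition max_unramified :: "(complex \<Rightarrow> real) \<Rightarrow> complex set \<Rightarrow> complex set" where
  "max_unramified v F = \<Union>{L. finite_ext F L \<and> v ` L = v ` F}"

definition good_model ::
    "(complex \<Rightarrow> real) \<Rightarrow> complex set \<Rightarrow> weierstrass \<Rightarrow>
     complex \<Rightarrow> complex \<Rightarrow> complex \<Rightarrow> complex \<Rightarrow> bool" where
  "good_model v L E u r s t \<longleftrightarrow> {u, r, s, t} \<subseteq> L \<and> u \<noteq> 0
     \<and> coeffs_in (val_ring v L) (change_coords u r s t E) \<and> v (disc (change_coords u r s t E)) = 1"

definition good_reduction :: "(complex \<Rightarrow> real) \<Rightarrow> complex set \<Rightarrow> weierstrass \<Rightarrow> bool" where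
  "good_reduction v L E \<longleftrightarrow> (\<exists>u r s t. good_model v L E u r s t)"

text \<open>The reduced curve has a node iff its discriminant vanishes and its \<open>c\<^sub>4\<close> does not;
  a model with this property is automatically minimal.\<close>

definition multiplicative_reduction ::
    "(complex \<Rightarrow> real) \<Rightarrow> complex set \<Rightarrow> weierstrass \<Rightarrow> bool" where
  "multiplicative_reduction v L E \<longleftrightarrow> (\<exists>u r s t. {u, r, s, t} \<subseteq> L \<and> u \<noteq> 0
     \<and> coeffs_in (val_ring v L) (change_coords u r s t E)
     \<and> v (disc (change_coords u r s t E)) < 1 \<and> v (c4 (change_coords u r s t E)) = 1)"

definition semistable_reduction :: "(complex \<Rightarrow> real) \<Rightarrow> complex set \<Rightarrow> weierstrass \<Rightarrow> bool" where
  "semistable_reduction v L E \<longleftrightarrow> good_reduction v L E \<or> multiplicative_reduction v L E"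

definition K_unr :: "(complex \<Rightarrow> real) \<Rightarrow> complex set \<Rightarrow> complex set" where
  "K_unr v K = max_unramified v (completion v K)"

definition K_ss :: "(complex \<Rightarrow> real) \<Rightarrow> complex set \<Rightarrow> weierstrass \<Rightarrow> complex set" where
  "K_ss v K E = (THE M. finite_ext (K_unr v K) M \<and> semistable_reduction v M E
     \<and> (\<forall>M'. finite_ext (K_unr v K) M' \<and> semistable_reduction v M' E \<longrightarrow> M \<subseteq> M'))"

definition e_index :: "(complex \<Rightarrow> real) \<Rightarrow> nat \<Rightarrow> complex set \<Rightarrow> weierstrass \<Rightarrow> int" where
  "e_index v l K E =
     normalized_val v K (of_nat l) * int (THE n. is_degree (K_unr v K) (K_ss v K E) n)"

section \<open>Tate--Oort numbers\<close>

text \<open>Homogeneous coordinates in the model given by \<^const>\<open>change_coords\<close>.\<close>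

fun model_coords ::
    "complex \<Rightarrow> complex \<Rightarrow> complex \<Rightarrow> complex \<Rightarrow> point \<Rightarrow> complex ^ 3" where
  "model_coords u r s t Infinity = vector [0, 1, 0]"
| "model_coords u r s t (Affine x y) =
     vector [(x - r) / u\<^sup>2, (y - s * (x - r) - t) / u ^ 3, 1]"

definition lin_form :: "complex ^ 3 \<Rightarrow> complex ^ 3 \<Rightarrow> complex" where
  "lin_form h z = (\<Sum>i\<in>UNIV. h $ i * z $ i)"

text \<open>The integral linear form \<open>h\<close> takes unit values at the primitive homogeneous coordinates
  of the points of \<open>W\<close>: their schematic closure lies in the affine open \<open>h \<noteq> 0\<close> of the
  projective plane over the valuation ring \<open>R\<close>. Such \<open>h\<close> exists for finite \<open>W\<close> when the residue
  field is infinite.\<close>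

definition avoids ::
    "(complex \<Rightarrow> real) \<Rightarrow> complex set \<Rightarrow> (point \<Rightarrow> complex ^ 3) \<Rightarrow> point set \<Rightarrow> complex ^ 3 \<Rightarrow> bool" where
  "avoids v R hc W h \<longleftrightarrow> (\<forall>i. h $ i \<in> R)
     \<and> (\<forall>P\<in>W. lin_form h (hc P) \<noteq> 0 \<and> (\<forall>i. v (hc P $ i) \<le> v (lin_form h (hc P))))"

text \<open>The \<open>R\<close>-algebra of functions generated by the affine coordinates on \<open>h \<noteq> 0\<close>. Restricted
  to a finite Galois stable set \<open>W\<close> of points it is the coordinate ring of the schematic closure
  of \<open>W\<close>; only the values on \<open>W\<close> are relevant.\<close>

inductive_set coord_ring ::
    "complex set \<Rightarrow> (point \<Rightarrow> complex ^ 3) \<Rightarrow> complex ^ 3 \<Rightarrow> (point \<Rightarrow> complex) set"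
  for R hc h where
  const: "c \<in> R \<Longrightarrow> (\<lambda>_. c) \<in> coord_ring R hc h"
| coord: "(\<lambda>P. hc P $ i / lin_form h (hc P)) \<in> coord_ring R hc h"
| add: "f \<in> coord_ring R hc h \<Longrightarrow> g \<in> coord_ring R hc h \<Longrightarrow> (\<lambda>P. f P + g P) \<in> coord_ring R hc h"
| mult: "f \<in> coord_ring R hc h \<Longrightarrow> g \<in> coord_ring R hc h \<Longrightarrow> (\<lambda>P. f P * g P) \<in> coord_ring R hc h"

text \<open>The coordinate ring of the quotient of \<open>G\<close> by a finite flat subgroup: functions invariant
  under translation.\<close>

definition quotient_ring ::
    "weierstrass \<Rightarrow> point set \<Rightarrow> point set \<Rightarrow> (point \<Rightarrow> complex) set \<Rightarrow> (point \<Rightarrow> complex) set" where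
  "quotient_ring E G V A = {f \<in> A. \<forall>P\<in>G. \<forall>Q\<in>V. f (add_point E P Q) = f P}"

text \<open>The algebra of the functions in \<open>A\<close> on \<open>W\<close> is \<open>R[x]/(x\<^sup>l - a x)\<close>. The relation and the
  generation by \<open>x\<close> suffice, as both sides are free \<open>R\<close>-modules of the same rank \<open>l\<close>.\<close>

definition oort_tate_parameter ::
    "nat \<Rightarrow> complex set \<Rightarrow> point set \<Rightarrow> (point \<Rightarrow> complex) set \<Rightarrow> complex \<Rightarrow> bool" where
  "oort_tate_parameter l R W A a \<longleftrightarrow> a \<in> R \<and>
     (\<exists>x\<in>A. (\<forall>P\<in>W. x P ^ l = a * x P)
        \<and> (\<forall>f\<in>A. \<exists>p :: complex poly. (\<forall>i. poly.coeff p i \<in> R) \<and> (\<forall>P\<in>W. f P = poly p (x P))))"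

text \<open>The filtration step \<open>V\<close> is the line spanned by the first vector of the basis given by \<open>g\<close>.
  In the good reduction case \<open>x1\<close> and \<open>x2\<close> are the Oort--Tate parameters of the graded pieces.\<close>

definition tate_oort_numbers ::
    "(complex \<Rightarrow> real) \<Rightarrow> complex set \<Rightarrow> weierstrass \<Rightarrow> 'p::prime_card mod_ring ^ 2 ^ 2 \<Rightarrow>
     int \<Rightarrow> int \<Rightarrow> bool" where
  "tate_oort_numbers v K E g j1 j2 \<longleftrightarrow>
     (let l = CARD('p); M = K_ss v K E; R = val_ring v M;
          G = torsion E l; V = range (\<lambda>k. torsion_iso E (k *s column 1 g))
      in (\<exists>u r s t h x1 x2. good_model v M E u r s t
            \<and> avoids v R (model_coords u r s t) G h
            \<and> oort_tate_parameter l R V (coord_ring R (model_coords u r s t) h) x1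
            \<and> oort_tate_parameter l R G
                 (quotient_ring E G V (coord_ring R (model_coords u r s t) h)) x2
            \<and> j1 = normalized_val v M x1 \<and> j2 = normalized_val v M x2)
       \<or> (multiplicative_reduction v M E \<and> {j1, j2} = {0, e_index v l K E}))"

definition balanced :: "'p::prime_card itself \<Rightarrow> complex set \<Rightarrow> weierstrass \<Rightarrow> complex set \<Rightarrow> bool" where
  "balanced _ K E \<ll> \<longleftrightarrow> heavenly CARD('p) K E
     \<and> (\<exists>v. induces_prime v K \<ll>
          \<and> (\<exists>(g :: 'p mod_ring ^ 2 ^ 2) i1 i2 j1 j2.
               triangular_form K E g i1 i2 \<and> tate_oort_numbers v K E g j1 j2
               \<and> 2 * j1 = e_index v CARD('p) K E \<and> 2 * j2 = e_index v CARD('p) K E))"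

text \<open>Congruence of rational numbers modulo \<open>m\<close>. An integer is congruent to
  \<open>(l + 1) / 4\<close> modulo \<open>l - 1\<close> only if \<open>(l + 1) / 4\<close> is an integer.\<close>

definition rat_cong :: "rat \<Rightarrow> rat \<Rightarrow> int \<Rightarrow> bool" where
  "rat_cong x y m \<longleftrightarrow> (\<exists>k::int. x - y = of_int (k * m))"

definition totally_balanced ::
    "'p::prime_card itself \<Rightarrow> complex set \<Rightarrow> weierstrass \<Rightarrow> complex set \<Rightarrow> bool" where
  "totally_balanced T K E \<ll> \<longleftrightarrow> balanced T K E \<ll>
     \<and> (\<exists>(g :: 'p mod_ring ^ 2 ^ 2) i1 i2.
          triangular_form K E g i1 i2 \<and>
          (let l = rat_of_nat CARD('p); m = int CARD('p) - 1;
               i = rat_of_int i1; i' = rat_of_int i2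
           in (rat_cong i ((l + 1) / 4) m \<and> rat_cong i' ((3 * l - 1) / 4) m)
            \<or> (rat_cong i ((3 * l - 1) / 4) m \<and> rat_cong i' ((l + 1) / 4) m)))"

end

theory Submission
  imports Defs
begin

text \<open>Write \<open>l = 4 a - 1\<close>. The trace at \<open>\<sigma>\<close> is \<open>x\<^sup>a (1 + x\<^bsup>(l-1)/2\<^esup>)\<close> with
  \<open>x = \<chi>(\<sigma>)\<close>, because the two exponents differ by \<open>(l - 1) / 2\<close>. It vanishes if \<open>x\<close> is a
  non-residue; otherwise it is \<open>2 x\<^sup>a\<close>, where \<open>x\<^sup>a\<close> is a square and
  \<open>2 = (2/l) (2\<^sup>a)\<^sup>2\<close> by Euler's criterion.\<close>

section \<open>Galois action on roots of unity\<close>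

text \<open>\<open>abs_gal\<close> only asks for additivity and multiplicativity on
  \<open>Qbar\<close>: \<open>\<sigma> 1\<close> is idempotent, hence 0 or 1, and injectivity
  excludes 0.\<close>

lemma abs_gal_one:
  assumes "\<sigma> \<in> abs_gal F"
  shows "\<sigma> 1 = 1"
proof -
  have bij: "bij_betw \<sigma> Qbar Qbar"
    and hom: "\<And>x y. x \<in> Qbar \<Longrightarrow> y \<in> Qbar \<Longrightarrow> \<sigma> (x + y) = \<sigma> x + \<sigma> y \<and> \<sigma> (x * y) = \<sigma> x * \<sigma> y"
    using assms by (auto simp: abs_gal_def)
  have mem: "(0::complex) \<in> Qbar" "(1::complex) \<in> Qbar"
    by (auto simp: Qbar_def)
  have "\<sigma> 0 = 0" "\<sigma> 1 * \<sigma> 1 = \<sigma> 1"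
    using hom[of 0 0] hom[of 1 1] mem by auto
  moreover have "\<sigma> 1 \<noteq> \<sigma> 0"
    using inj_onD[OF bij_betw_imp_inj_on[OF bij], of 1 0] mem by auto
  ultimately show ?thesis by auto
qed

lemma root_of_unity_in_Qbar:
  assumes "\<zeta> ^ n = 1" "n > 0"
  shows "\<zeta> \<in> Qbar"
proof -
  have "algebraic_int \<zeta>"
    by (rule algebraic_int_root[where p = "Polynomial.monom 1 n" and y = 1])
      (use assms in \<open>auto simp: poly_monom Polynomial.degree_monom_eq\<close>)
  then show ?thesis by (auto simp: Qbar_def)
qed

text \<open>Being a root of unity keeps all powers of \<open>\<zeta>\<close> inside
  \<open>Qbar\<close>, where \<open>\<sigma>\<close> is given to be multiplicative.\<close>

lemma abs_gal_power:
  assumes "\<sigma> \<in> abs_gal F" "\<zeta> ^ n = 1" "n > 0"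
  shows "\<sigma> (\<zeta> ^ k) = \<sigma> \<zeta> ^ k"
proof (induction k)
  case 0
  show ?case using abs_gal_one[OF assms(1)] by simp
next
  case (Suc k)
  have "(\<zeta> ^ k) ^ n = 1"
    using assms(2) by (metis mult.commute power_mult power_one)
  then have "\<zeta> \<in> Qbar" "\<zeta> ^ k \<in> Qbar"
    using assms root_of_unity_in_Qbar by blast+
  then have "\<sigma> (\<zeta> * \<zeta> ^ k) = \<sigma> \<zeta> * \<sigma> (\<zeta> ^ k)"
    using assms(1) by (auto simp: abs_gal_def)
  then show ?case using Suc by simp
qed

lemma primitive_root_of_unity:
  assumes "n > 0"
  obtains \<zeta> :: complex where "bij_betw (\<lambda>k. \<zeta> ^ k) {..<n} {z. z ^ n = 1}"
proof
  have "(\<lambda>k. cis (2 * pi / n) ^ k) = (\<lambda>k. cis (2 * pi * real k / real n))"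
    by (intro ext) (simp add: Complex.DeMoivre mult_ac)
  then show "bij_betw (\<lambda>k. cis (2 * pi / n) ^ k) {..<n} {z. z ^ n = 1}"
    using Complex.bij_betw_roots_unity[OF assms] by simp
qed

section \<open>The mod \<open>l\<close> cyclotomic character\<close>

text \<open>The point is that the \<open>THE\<close> in \<open>cyclo_char\<close> is well defined: a
  generator \<open>\<omega>\<close> of the \<open>l\<close>-th roots of unity goes to some
  \<open>\<omega> ^ k\<close>, which fixes \<open>\<sigma>\<close> on all of them, and
  \<open>k < l\<close> is unique because the powers of \<open>\<omega>\<close> below
  \<open>l\<close> are distinct.\<close>

lemma cyclo_char_root_of_unity:
  fixes \<zeta> :: complex
  assumes \<sigma>: "\<sigma> \<in> abs_gal F" and "\<zeta> ^ CARD('p::prime_card) = 1"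
  shows "\<sigma> \<zeta> = \<zeta> ^ nat (to_int_mod_ring (cyclo_char \<sigma> :: 'p mod_ring))"
proof -
  let ?l = "CARD('p)"
  let ?P = "\<lambda>c :: 'p mod_ring. \<forall>\<zeta>. \<zeta> ^ ?l = 1 \<longrightarrow> \<sigma> \<zeta> = \<zeta> ^ nat (to_int_mod_ring c)"
  have l: "?l > 1" by (rule nontriv)
  obtain \<omega> :: complex where \<omega>: "bij_betw (\<lambda>k. \<omega> ^ k) {..<?l} {z. z ^ ?l = 1}"
    using primitive_root_of_unity[of ?l] l by auto
  \<comment> \<open>The bijection is evaluated at the exponent 1, which lies below
    \<open>l\<close>.\<close>
  have \<omega>1: "\<omega> ^ ?l = 1"
    using bij_betwE[OF \<omega>, rule_format, of 1] l by auto
  have "\<sigma> \<omega> ^ ?l = 1"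
    using abs_gal_power[OF \<sigma> \<omega>1, of ?l] abs_gal_one[OF \<sigma>] \<omega>1 l by simp
  then obtain k where k: "k < ?l" "\<sigma> \<omega> = \<omega> ^ k"
    using \<omega> by (auto simp: bij_betw_def set_eq_iff image_iff)
  have tok: "to_int_mod_ring (of_nat k :: 'p mod_ring) = int k"
    using k(1) by (simp add: of_nat_of_int_mod_ring)
  have "?P (of_nat k)"
  proof (intro allI impI)
    fix z :: complex assume "z ^ ?l = 1"
    then obtain j where "z = \<omega> ^ j"
      using \<omega> by (auto simp: bij_betw_def set_eq_iff image_iff)
    then show "\<sigma> z = z ^ nat (to_int_mod_ring (of_nat k :: 'p mod_ring))"
      using abs_gal_power[OF \<sigma> \<omega>1, of j] l k(2)
      by (simp add: tok mult.commute flip: power_mult)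
  qed
  moreover have "c = of_nat k" if "?P c" for c
  proof -
    have range: "0 \<le> to_int_mod_ring c" "to_int_mod_ring c < int ?l"
      using range_to_int_mod_ring[where 'a = 'p] by auto
    have "\<omega> ^ nat (to_int_mod_ring c) = \<omega> ^ k"
      using that \<omega>1 k(2) by metis
    then have "nat (to_int_mod_ring c) = k"
      using \<omega> k(1) range by (auto simp: bij_betw_def inj_on_def)
    then have "to_int_mod_ring c = to_int_mod_ring (of_nat k :: 'p mod_ring)"
      using range tok by simp
    then show ?thesis
      by (metis of_int_mod_ring_to_int_mod_ring)
  qed
  ultimately have "?P (cyclo_char \<sigma>)"
    unfolding cyclo_char_def by (rule theI)
  then show ?thesis using assms(2) by blast
qed

text \<open>The value 0 would send a generator to \<open>\<omega> ^ 0 = 1 = \<sigma> 1\<close>,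
  against injectivity. Nonvanishing is what allows exponents to be reduced modulo
  \<open>l - 1\<close>.\<close>

lemma cyclo_char_nonzero:
  assumes \<sigma>: "\<sigma> \<in> abs_gal F"
  shows "(cyclo_char \<sigma> :: 'p::prime_card mod_ring) \<noteq> 0"
proof
  assume 0: "(cyclo_char \<sigma> :: 'p mod_ring) = 0"
  have l: "CARD('p) > 1" by (rule nontriv)
  obtain \<omega> :: complex where \<omega>: "bij_betw (\<lambda>k. \<omega> ^ k) {..<CARD('p)} {z. z ^ CARD('p) = 1}"
    using primitive_root_of_unity[of "CARD('p)"] l by auto
  have \<omega>1: "\<omega> ^ CARD('p) = 1"
    using bij_betwE[OF \<omega>, rule_format, of 1] l by auto
  have "\<omega> \<noteq> 1"
  proof
    assume "\<omega> = 1"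
    then show False
      using inj_onD[OF bij_betw_imp_inj_on[OF \<omega>], of 0 1] l by simp
  qed
  moreover have "\<sigma> \<omega> = \<sigma> 1"
    using cyclo_char_root_of_unity[OF \<sigma> \<omega>1] 0 abs_gal_one[OF \<sigma>] by simp
  moreover have "\<omega> \<in> Qbar" "(1::complex) \<in> Qbar"
    using root_of_unity_in_Qbar[OF \<omega>1] by (auto simp: Qbar_def)
  ultimately show False
    using \<sigma> by (auto simp: abs_gal_def bij_betw_def inj_on_def)
qed

section \<open>Traces, and exponents modulo \<open>l - 1\<close>\<close>

lemma trace_conjugate:
  fixes g M :: "'a::comm_ring_1 ^ 'n ^ 'n"
  assumes "invertible g"
  shows "trace (matrix_inv g ** M ** g) = trace M"
proof -
  have "g ** matrix_inv g = mat 1"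
    using assms unfolding invertible_def matrix_inv_def by (rule someI2_ex) auto
  then show ?thesis
    by (metis matrix_mul_assoc matrix_mul_lid trace_mul_sym)
qed

lemma mod_ring_power_pred_card:
  fixes x :: "'p::prime_card mod_ring"
  assumes "x \<noteq> 0"
  shows "x ^ (CARD('p) - 1) = 1"
proof -
  have "x * x ^ (CARD('p) - 1) = x * 1"
    using finite_field_power_card_eq_same[of x] nontriv[where 'a = 'p]
    by (simp flip: power_Suc)
  then show ?thesis using assms by simp
qed

lemma power_int_cong_exponent:
  fixes x :: "'a::field"
  assumes "x \<noteq> 0" "x ^ m = 1" "i = int k + j * int m"
  shows "x powi i = x ^ k"
proof -
  have "x powi (j * int m) = 1"
    using assms(2) by (simp add: mult.commute[of j] power_int_mult)
  then show ?thesis using assms by (simp add: power_int_add)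
qed

text \<open>Clearing the denominator leaves an equation of integers, from which divisibility of
  \<open>b\<close> by 4 can be read off.\<close>

lemma rat_cong_quarter:
  assumes "rat_cong (of_int i) (of_int b / 4) m"
  obtains j where "4 * i = b + 4 * j * m"
proof -
  from assms obtain j where "of_int i - of_int b / (4::rat) = of_int (j * m)"
    by (auto simp: rat_cong_def)
  then have "(of_int (4 * i) :: rat) = of_int (b + 4 * j * m)"
    by (simp add: field_simps)
  then show thesis using that by (simp only: of_int_eq_iff)
qed

section \<open>Quadratic residues in the prime field\<close>

text \<open>Euler's criterion, carried from a congruence modulo \<open>l\<close> to an equality in
  the field of characteristic \<open>l\<close>.\<close>

lemma Legendre_mod_ring:
  assumes "CARD('p::prime_card) > 2"
  shows "(of_int (Legendre c (int CARD('p))) :: 'p mod_ring) = of_int c ^ ((CARD('p) - 1) div 2)"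
  using euler_criterion[OF prime_card assms, of c]
  by (simp add: of_int_eq_iff_cong_CHAR flip: of_int_power)

text \<open>For \<open>l = 4 * a - 1\<close> the exponents \<open>a\<close> and
  \<open>3 * a - 1\<close> are \<open>(l + 1) / 4\<close> and \<open>(3 * l - 1) / 4\<close>, so
  this sum is the trace when \<open>x\<close> is a value of the cyclotomic character.\<close>

lemma power_sum_in_Legendre_2_squares:
  fixes x :: "'p::prime_card mod_ring"
  assumes "x \<noteq> 0" and a: "CARD('p) + 1 = 4 * a"
  shows "x ^ a + x ^ (3 * a - 1)
    \<in> (\<lambda>x. of_int (Legendre 2 (int CARD('p))) * x) ` {s\<^sup>2 | s. s \<noteq> 0} \<union> {0}"
proof -
  \<comment> \<open>Thus \<open>2 * a - 1\<close> is \<open>(l - 1) / 2\<close>, the exponent of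
    Euler's criterion.\<close>
  have card: "a > 0" "CARD('p) - 1 = 2 * (2 * a - 1)" "CARD('p) > 2"
    using a nontriv[where 'a = 'p] by presburger+
  have "(x ^ (2 * a - 1))\<^sup>2 = 1"
    using mod_ring_power_pred_card[OF assms(1)] card(2)
    by (simp add: mult.commute flip: power_mult)
  then consider "x ^ (2 * a - 1) = 1" | "x ^ (2 * a - 1) = -1"
    using power2_eq_1_iff by blast
  moreover have sum: "x ^ a + x ^ (3 * a - 1) = x ^ a * (1 + x ^ (2 * a - 1))"
    using card(1) by (simp add: distrib_left flip: power_add)
  ultimately show ?thesis
  proof cases
    case 1
    let ?L = "of_int (Legendre 2 (int CARD('p))) :: 'p mod_ring"
    have two: "(2 :: 'p mod_ring) \<noteq> 0"
    proof
      assume "(2 :: 'p mod_ring) = 0"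
      then have "CARD('p) dvd 2"
        using of_nat_0_mod_ring_dvd[of 2, where 'a = 'p] by simp
      then show False using card(3) by (auto dest: dvd_imp_le)
    qed
    have L: "?L = 2 ^ (2 * a - 1)"
      using Legendre_mod_ring[OF card(3), of 2] card(2) by simp
    have L_sq: "?L * ?L = 1"
      using mod_ring_power_pred_card[OF two] card(2) by (simp add: L mult_2 flip: power_add)
    have L_two: "?L * 2 = (2 ^ a)\<^sup>2"
    proof -
      have "?L * 2 = 2 ^ Suc (2 * a - 1)" by (simp add: L)
      also have "Suc (2 * a - 1) = a * 2" using card(1) by simp
      finally show ?thesis by (simp only: power_mult)
    qed
    \<comment> \<open>The symbol is its own inverse, so it can be moved across \<open>L_two\<close>
      to present 2 as the symbol times a square.\<close>
    have "?L * (?L * 2) = 2"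
      unfolding mult.assoc[symmetric] L_sq by simp
    then have two_eq: "2 = ?L * (2 ^ a)\<^sup>2"
      unfolding L_two by (rule sym)
    \<comment> \<open>In the residue case \<open>x = x * x ^ (2 * a - 1) = x ^ (2 * a)\<close>,
      which makes \<open>x ^ a\<close> an explicit square root of \<open>x\<close>.\<close>
    have x_eq: "x = (x ^ a)\<^sup>2"
    proof -
      have "(x ^ a)\<^sup>2 = x ^ Suc (2 * a - 1)"
        using card(1) by (simp add: mult.commute flip: power_mult)
      then show ?thesis using 1 by simp
    qed
    have x_pow: "x ^ a = ((x ^ a) ^ a)\<^sup>2"
    proof -
      have "((x ^ a) ^ a)\<^sup>2 = ((x ^ a)\<^sup>2) ^ a"
        by (simp add: mult_ac flip: power_mult)
      then show ?thesis unfolding x_eq[symmetric] by (rule sym)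
    qed
    have "x ^ a + x ^ (3 * a - 1) = 2 * x ^ a"
      unfolding sum 1 by simp
    also have "\<dots> = (?L * (2 ^ a)\<^sup>2) * ((x ^ a) ^ a)\<^sup>2"
      by (rule arg_cong2[where f = "(*)", OF two_eq x_pow])
    also have "\<dots> = ?L * (2 ^ a * (x ^ a) ^ a)\<^sup>2"
      by (simp only: power_mult_distrib mult.assoc)
    finally have "x ^ a + x ^ (3 * a - 1) = ?L * (2 ^ a * (x ^ a) ^ a)\<^sup>2" .
    moreover have "2 ^ a * (x ^ a) ^ a \<noteq> 0"
      using two assms(1) by simp
    ultimately show ?thesis by blast
  next
    case 2
    then show ?thesis using sum by simp
  qed
qed

theorem proposition3p8:
  fixes K \<ll> :: "complex set" and n :: nat and E :: weierstrass
  assumes "subfield K \<C>" and "is_degree \<rat> K n" and "odd n" and "galois_ext \<rat> K"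
    and "elliptic_curve K E"
    and "odd CARD('p::prime_card)"
    and "prime_above K CARD('p) \<ll>"
    and "totally_balanced TYPE('p) K E \<ll>"
  shows "trace ` (rho E :: _ \<Rightarrow> 'p mod_ring ^ 2 ^ 2) ` abs_gal K
           \<subseteq> (\<lambda>x. of_int (Legendre 2 (int CARD('p))) * x) ` {s\<^sup>2 | s. s \<noteq> 0} \<union> {0}"
proof -
  let ?m = "int CARD('p) - 1"
  let ?exponents = "\<lambda>i i'. rat_cong (of_int i) (of_int (int CARD('p) + 1) / 4) ?m
    \<and> rat_cong (of_int i') (of_int (3 * int CARD('p) - 1) / 4) ?m"
  from assms(8) obtain g :: "'p mod_ring ^ 2 ^ 2" and i1 i2 where
    tri: "triangular_form K E g i1 i2" and exps: "?exponents i1 i2 \<or> ?exponents i2 i1"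
    by (auto simp: totally_balanced_def Let_def)
  have trace_eq: "trace (rho E \<sigma> :: 'p mod_ring ^ 2 ^ 2) = cyclo_char \<sigma> powi i1 + cyclo_char \<sigma> powi i2"
    if "\<sigma> \<in> abs_gal K" for \<sigma>
  proof -
    have "trace (rho E \<sigma>) = trace (matrix_inv g ** rho E \<sigma> ** g)"
      using tri trace_conjugate[of g] by (simp add: triangular_form_def)
    also have "\<dots> = cyclo_char \<sigma> powi i1 + cyclo_char \<sigma> powi i2"
      using tri that by (simp add: triangular_form_def Let_def trace_def sum_2)
    finally show ?thesis .
  qed
  \<comment> \<open>The trace is symmetric in the two exponents, so they may be named such that
    \<open>i\<close> belongs to \<open>(l + 1) / 4\<close>.\<close>
  obtain i i' where ii': "?exponents i i'" "{i, i'} = {i1, i2}"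
    using exps by blast
  obtain j where j: "4 * i = int CARD('p) + 1 + 4 * j * ?m"
    using ii'(1) rat_cong_quarter by blast
  obtain j' where j': "4 * i' = 3 * int CARD('p) - 1 + 4 * j' * ?m"
    using ii'(1) rat_cong_quarter by blast
  \<comment> \<open>Integrality of \<open>i\<close> forces \<open>l\<close> to be 3 modulo 4.
    Writing \<open>int 4\<close> lets the divisibility descend to natural numbers.\<close>
  have "int (CARD('p) + 1) = int 4 * (i - j * ?m)"
    using j by (simp add: algebra_simps)
  then have "int 4 dvd int (CARD('p) + 1)"
    by (rule dvdI)
  then obtain a where a: "CARD('p) + 1 = 4 * a"
    unfolding of_nat_dvd_iff by blast
  have m: "int (CARD('p) - 1) = ?m" and "a > 0"
    using a by auto
  have i: "i = int a + j * int (CARD('p) - 1)"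
    and i': "i' = int (3 * a - 1) + j' * int (CARD('p) - 1)"
    using j j' a \<open>a > 0\<close> unfolding m by (auto simp: algebra_simps of_nat_diff)
  have "trace (rho E \<sigma> :: 'p mod_ring ^ 2 ^ 2) = cyclo_char \<sigma> ^ a + cyclo_char \<sigma> ^ (3 * a - 1)"
    if \<sigma>: "\<sigma> \<in> abs_gal K" for \<sigma>
  proof -
    \<comment> \<open>By Fermat's little theorem the integer exponents matter only modulo
      \<open>l - 1\<close> and become \<open>a\<close> and \<open>3 * a - 1\<close>.\<close>
    note nz = cyclo_char_nonzero[OF \<sigma>, where 'p = 'p]
    note red = power_int_cong_exponent[OF nz mod_ring_power_pred_card[OF nz]]
    show ?thesis
      unfolding trace_eq[OF \<sigma>] red[OF i, symmetric] red[OF i', symmetric]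
      using ii'(2) by (auto simp: doubleton_eq_iff add.commute)
  qed
  then show ?thesis
    using power_sum_in_Legendre_2_squares[OF cyclo_char_nonzero a]
    unfolding image_image by (intro image_subsetI) (simp only:)
qed

end
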